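(* Let the stochastic game be as described in the context, and let $\phi:\prod_{i=1}^N[0,u_i^{max}]\to\mathbb{R}$ be concave, continuous and non-negative. Let $\phi^{max}$ be the maximum of $\phi$ over $\prod_{i=1}^N[0,u_i^{max}]$, and let $C=\sum_{i=1}^N(u_i^{max})^2$. Since $\phi$ is continuous on a compact set, it is Lipschitz continuous, so that there is a positive value $M$ (the Lipschitz constant) such that $|\phi(\gamma)-\phi(r)|\le M\|\gamma-r\|$ for all $\gamma,r\in\prod_{i=1}^N[0,u_i^{max}]$. Fix $V\ge0$ (for $V=0$ the terms divided by $V$ are understood as $+\infty$, so that the bounds are trivial), let $\{\omega(t)\}_{t\ge 0}$ in $\Omega$ and $\{b(t)\}_{t\ge 0}$ in $\mathcal{A}_1\times\cdots\times\mathcal{A}_N$ be arbitrary sequences, and suppose the general algorithm (described in the context) is used with this $V$ and with $Q_i(0)=Z_i(0)=0$ for all $i\in\{1,\dots,N\}$. Then for all positive integers $T$ and $K$: $$\phi(\overline{u}(KT))\ \ge\ \frac1K\sum_{k=0}^{K-1}\psi_T[k]-\frac{TC}{V}-M\sqrt{\frac{2C+2V\phi^{max}}{KT}},$$ and consequently, for every positive integer $T$, $$\liminf_{K\to\infty}\left[\phi(\overline{u}(KT))-\frac1K\sum_{k=0}^{K-1}\psi_T[k]\right]\ge-\frac{TC}{V},$$ where $\psi_T[k]$ is the $T$-slot lookahead value of frame $k$ defined in the context.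
   Context: Game. $N\ge 2$ is an integer (number of players). $\Omega$ and $\mathcal{A}_1,\dots,\mathcal{A}_N$ are arbitrary nonempty sets (event set and action sets). For each $i$, $\hat{u}_i:\mathcal{A}_1\times\cdots\times\mathcal{A}_N\times\Omega\to\mathbb{R}$ is a utility function with $0\le \hat{u}_i(\alpha,\omega)\le u_i^{max}$ for all $(\alpha,\omega)$, where $u_i^{max}<\infty$. It is assumed that for every $\omega\in\Omega$ and all real $\beta_1,\dots,\beta_N$, the supremum of $\sum_{i=1}^N\beta_i\hat{u}_i(\alpha,\omega)$ over $\alpha\in\mathcal{A}_1\times\cdots\times\mathcal{A}_N$ is attained. Sequences. $\omega(t)$ is the event vector and $b(t)=(b_1(t),\dots,b_N(t))$ the vector of baseline actions on round $t\in\{0,1,2,\dots\}$. For an action sequence $\alpha(t)=(\alpha_1(t),\dots,\alpha_N(t))$ define $u_i(t)=\hat{u}_i(\alpha(t),\omega(t))$, $x_i(t)=\hat{u}_i(b(t),\omega(t))$, and for $t\geq 1$, $\overline{u}_i(t)=\frac1t\sum_{\tau=0}^{t-1}u_i(\tau)$, $\overline{u}(t)=(\overline{u}_1(t),\dots,\overline{u}_N(t))$. General algorithm with parameter $V$. It maintains $Q(t)=(Q_1(t),\dots,Q_N(t))$ and $Z(t)=(Z_1(t),\dots,Z_N(t))$. On every round $t\in\{0,1,2,\dots\}$: (1) choose $\gamma(t)=(\gamma_1(t),\dots,\gamma_N(t))$ as a maximizer of $V\phi(\gamma)-\sum_{i=1}^NZ_i(t)\gamma_i$ over $\gamma\in\prod_{i=1}^N[0,u_i^{max}]$;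 (2) choose $\alpha(t)$ as a maximizer of $\sum_{i=1}^N\hat{u}_i(\alpha,\omega(t))[Q_i(t)+Z_i(t)]$ over $\alpha\in\mathcal{A}_1\times\cdots\times\mathcal{A}_N$; (3) update, for each $i$, $Q_i(t+1)=\max[Q_i(t)+x_i(t)-u_i(t),0]$ and $Z_i(t+1)=Z_i(t)+\gamma_i(t)-u_i(t)$. $T$-slot lookahead value. For a positive integer $T$ and an integer $k\ge0$, $\psi_T[k]$ is the supremum of $\phi(\gamma_1,\dots,\gamma_N)$ over all choices of $\gamma_i\in[0,u_i^{max}]$ and $\alpha(\tau)\in\mathcal{A}_1\times\cdots\times\mathcal{A}_N$ for $\tau\in\{kT,\dots,(k+1)T-1\}$ such that, for all $i\in\{1,\dots,N\}$, $\gamma_i=\frac1T\sum_{\tau=kT}^{(k+1)T-1}\hat{u}_i(\alpha(\tau),\omega(\tau))$ and $\gamma_i\ge\frac1T\sum_{\tau=kT}^{(k+1)T-1}\hat{u}_i(b(\tau),\omega(\tau))$. $\|\cdot\|$ is the Euclidean norm.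
   Formalization: Continuity on a compact set does not imply Lipschitz continuity (e.g. the square root of one coordinate), so existence of M is not claimed: the first bound is proved for every M > 0 that is a Lipschitz constant of φ; the liminf bound is proved with no Lipschitz assumption. *)

theory Defs
  imports "HOL-Analysis.Analysis" "HOL-Library.Extended_Real" "HOL-Library.Liminf_Limsup"
begin

(* Players are indexed by the finite type 'n.  The action sets A i may be unrelated to each
   other; they are taken as subsets of a common type 'a (e.g. their disjoint union).
   The i-th utility of the joint action a under the event w is uhat a w $ i. *)

abbreviation joint_actions :: "('n \<Rightarrow> 'a set) \<Rightarrow> ('n \<Rightarrow> 'a) set" where
  "joint_actions A \<equiv> Pi UNIV A"

locale stochastic_game =
  fixes Omega :: "'w set"
    and A :: "'n::finite \<Rightarrow> 'a set"
    and uhat :: "('n \<Rightarrow> 'a) \<Rightarrow> 'w \<Rightarrow> real ^ 'n"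
    and umax :: "real ^ 'n"
  assumes players: "CARD('n) \<ge> 2"
    and Omega_nonempty: "Omega \<noteq> {}"
    and actions_nonempty: "\<And>i. A i \<noteq> {}"
    and utility_bounds: "\<And>a w i. a \<in> joint_actions A \<Longrightarrow> w \<in> Omega \<Longrightarrow>
      0 \<le> uhat a w $ i \<and> uhat a w $ i \<le> umax $ i"
    and sup_attained: "\<And>w (\<beta> :: 'n \<Rightarrow> real). w \<in> Omega \<Longrightarrow>
      \<exists>a. is_arg_max (\<lambda>a. \<Sum>i\<in>UNIV. \<beta> i * uhat a w $ i) (\<lambda>a. a \<in> joint_actions A) a"

(* cbox 0 umax is the product of the intervals [0, umax $ i]. *)

definition general_algorithm ::
  "('n::finite \<Rightarrow> 'a set) \<Rightarrow> (('n \<Rightarrow> 'a) \<Rightarrow> 'w \<Rightarrow> real ^ 'n) \<Rightarrow> real ^ 'n \<Rightarrow> (real ^ 'n \<Rightarrow> real) \<Rightarrow> real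
    \<Rightarrow> (nat \<Rightarrow> 'w) \<Rightarrow> (nat \<Rightarrow> 'n \<Rightarrow> 'a)
    \<Rightarrow> (nat \<Rightarrow> real ^ 'n) \<Rightarrow> (nat \<Rightarrow> 'n \<Rightarrow> 'a) \<Rightarrow> (nat \<Rightarrow> real ^ 'n) \<Rightarrow> (nat \<Rightarrow> real ^ 'n) \<Rightarrow> bool" where
  "general_algorithm A uhat umax \<phi> V \<omega> b \<gamma> \<alpha> Q Z \<longleftrightarrow>
    (\<forall>t.
      is_arg_max (\<lambda>g. V * \<phi> g - (\<Sum>i\<in>UNIV. Z t $ i * g $ i)) (\<lambda>g. g \<in> cbox 0 umax) (\<gamma> t) \<and>
      is_arg_max (\<lambda>a. \<Sum>i\<in>UNIV. uhat a (\<omega> t) $ i * (Q t $ i + Z t $ i))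
        (\<lambda>a. a \<in> joint_actions A) (\<alpha> t) \<and>
      (\<forall>i. Q (Suc t) $ i = max (Q t $ i + uhat (b t) (\<omega> t) $ i - uhat (\<alpha> t) (\<omega> t) $ i) 0) \<and>
      (\<forall>i. Z (Suc t) $ i = Z t $ i + \<gamma> t $ i - uhat (\<alpha> t) (\<omega> t) $ i))"

definition average_utility ::
  "(('n::finite \<Rightarrow> 'a) \<Rightarrow> 'w \<Rightarrow> real ^ 'n) \<Rightarrow> (nat \<Rightarrow> 'w) \<Rightarrow> (nat \<Rightarrow> 'n \<Rightarrow> 'a) \<Rightarrow> nat \<Rightarrow> real ^ 'n" where
  "average_utility uhat \<omega> \<alpha> t = (\<chi> i. (1 / real t) * (\<Sum>\<tau><t. uhat (\<alpha> \<tau>) (\<omega> \<tau>) $ i))"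

(* In the intended use the set below is nonempty (take a = b) and bounded above, since \<phi> is
   continuous on a compact box, so Sup on the reals is the genuine supremum. *)

definition lookahead ::
  "('n::finite \<Rightarrow> 'a set) \<Rightarrow> (('n \<Rightarrow> 'a) \<Rightarrow> 'w \<Rightarrow> real ^ 'n) \<Rightarrow> real ^ 'n \<Rightarrow> (real ^ 'n \<Rightarrow> real)
    \<Rightarrow> (nat \<Rightarrow> 'w) \<Rightarrow> (nat \<Rightarrow> 'n \<Rightarrow> 'a) \<Rightarrow> nat \<Rightarrow> nat \<Rightarrow> real" where
  "lookahead A uhat umax \<phi> \<omega> b T k = Sup {\<phi> g | g a.
      g \<in> cbox 0 umax \<and>
      (\<forall>\<tau>\<in>{k * T..<(k + 1) * T}. a \<tau> \<in> joint_actions A) \<and>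
      (\<forall>i. g $ i = (1 / real T) * (\<Sum>\<tau>\<in>{k * T..<(k + 1) * T}. uhat (a \<tau>) (\<omega> \<tau>) $ i)) \<and>
      (\<forall>i. g $ i \<ge> (1 / real T) * (\<Sum>\<tau>\<in>{k * T..<(k + 1) * T}. uhat (b \<tau>) (\<omega> \<tau>) $ i))}"

(* Quotient by V >= 0 with the convention that a term divided by V = 0 is +infinity
   (even for numerator 0, where ereal division would give 0). *)

definition divide_or_infty :: "real \<Rightarrow> real \<Rightarrow> ereal" where
  "divide_or_infty x V = (if V = 0 then \<infinity> else ereal (x / V))"

end

theory Submission
  imports Defs
begin

text \<open>
  Drift-plus-penalty argument for the Lyapunov function \<open>L = (\<parallel>Q\<parallel>\<^sup>2 + \<parallel>Z\<parallel>\<^sup>2) / 2\<close>.  The algorithm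
  greedily minimises an upper bound on the one-round change of \<open>L - V \<phi>(\<gamma>)\<close>, so its choices may be
  replaced in this bound by any others.  Comparing with a feasible lookahead policy, the linear
  terms of a frame vanish up to \<open>O(T\<^sup>2)\<close>, because queues move by at most \<open>umax\<close> per round; since
  \<open>L \<ge> 0\<close> this bounds the average of \<open>\<phi>(\<gamma>)\<close> from below.  Comparing with the baseline actions gives
  \<open>L(t) \<le> (C + V \<phi>max) t\<close>, and \<open>Z(t) / t\<close> is the difference between the averages of \<open>\<gamma>\<close> and of
  the utilities.  For the limit, uniform continuity of \<open>\<phi>\<close> suffices; in fact a continuous concave
  \<open>\<phi>\<close> need not be Lipschitz (the square root).
\<close>

section \<open>Elementary bounds for inner products, averages and telescoping sums\<close>

lemma inner_mono_componentwise:
  fixes v w c d :: "real ^ 'n"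
  assumes "\<And>i. \<bar>v $ i\<bar> \<le> c $ i" and "\<And>i. \<bar>w $ i\<bar> \<le> d $ i"
  shows "v \<bullet> w \<le> c \<bullet> d"
proof -
  have "v $ i * w $ i \<le> c $ i * d $ i" for i
  proof -
    have "v $ i * w $ i \<le> \<bar>v $ i\<bar> * \<bar>w $ i\<bar>"
      by (metis abs_ge_self abs_mult)
    also have "\<dots> \<le> c $ i * d $ i"
      using assms[of i] by (intro mult_mono) auto
    finally show ?thesis .
  qed
  then show ?thesis
    by (simp add: inner_vec_def sum_mono)
qed

lemma abs_diff_le_of_cbox_0:
  fixes v w c :: "real ^ 'n"
  assumes "v \<in> cbox 0 c" "w \<in> cbox 0 c"
  shows "\<bar>(v - w) $ i\<bar> \<le> c $ i"
proof -
  have "0 \<le> v $ i" "v $ i \<le> c $ i" "0 \<le> w $ i" "w $ i \<le> c $ i"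
    using assms by (auto simp: mem_box_cart)
  then show ?thesis by simp
qed

lemma is_arg_max_ge:
  fixes f :: "'b \<Rightarrow> 'c::linorder"
  assumes "is_arg_max f P x" "P y"
  shows "f y \<le> f x"
  using assms by (auto simp: is_arg_max_def not_less)

lemma convex_average:
  fixes y :: "nat \<Rightarrow> 'b::real_vector"
  assumes "convex S" "\<And>t. y t \<in> S" "n > 0"
  shows "(1 / real n) *\<^sub>R (\<Sum>t<n. y t) \<in> S"
proof -
  have "(\<Sum>t<n. (1 / real n) *\<^sub>R y t) \<in> S"
    using assms by (intro convex_sum) auto
  then show ?thesis by (simp add: scaleR_sum_right)
qed

lemma concave_on_average_le:
  fixes y :: "nat \<Rightarrow> 'b::real_vector"
  assumes "concave_on S f" "\<And>t. y t \<in> S" "n > 0"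
  shows "(1 / real n) * (\<Sum>t<n. f (y t)) \<le> f ((1 / real n) *\<^sub>R (\<Sum>t<n. y t))"
proof -
  have "(\<Sum>t<n. (1 / real n) * f (y t)) \<le> f (\<Sum>t<n. (1 / real n) *\<^sub>R y t)"
    using assms by (intro concave_on_sum) (auto simp: concave_on_imp_convex)
  then show ?thesis by (simp add: scaleR_sum_right sum_distrib_left)
qed

lemma sum_telescope_le:
  fixes f :: "nat \<Rightarrow> 'b::ordered_ab_group_add"
  assumes "\<And>j. j < n \<Longrightarrow> f (Suc j) - f j \<le> g j"
  shows "f n - f 0 \<le> (\<Sum>j<n. g j)"
  using sum_mono[of "{..<n}" "\<lambda>j. f (Suc j) - f j" g] assms by (simp add: sum_lessThan_telescope)

lemma sum_frame:
  fixes f :: "nat \<Rightarrow> 'b::comm_monoid_add"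
  shows "(\<Sum>t\<in>{k * T..<k * T + T}. f t) = (\<Sum>j<T. f (k * T + j))"
  using sum.shift_bounds_nat_ivl[of f 0 "k * T" T] by (simp add: atLeast0LessThan add.commute)

section \<open>One run of the algorithm: greedy choices and queue updates\<close>

text \<open>Concavity, range and continuity of \<open>\<phi>\<close> are introduced only where they
  act: in Jensen's inequality, in the growth bound for \<open>lyapunov\<close>, and in the
  limit.\<close>

locale algorithm_run = stochastic_game Omega A uhat umax
  for Omega :: "'w set"
    and A :: "'n::finite \<Rightarrow> 'a set"
    and uhat :: "('n \<Rightarrow> 'a) \<Rightarrow> 'w \<Rightarrow> real ^ 'n"
    and umax :: "real ^ 'n" +
  fixes \<phi> :: "real ^ 'n \<Rightarrow> real"
    and V :: real
    and \<omega> :: "nat \<Rightarrow> 'w"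
    and b \<alpha> :: "nat \<Rightarrow> 'n \<Rightarrow> 'a"
    and \<gamma> Q Z :: "nat \<Rightarrow> real ^ 'n"
  assumes events: "\<And>t. \<omega> t \<in> Omega"
    and baseline: "\<And>t. b t \<in> joint_actions A"
    and algorithm: "general_algorithm A uhat umax \<phi> V \<omega> b \<gamma> \<alpha> Q Z"
    and Q_init: "Q 0 = 0"
    and Z_init: "Z 0 = 0"
begin

definition u :: "nat \<Rightarrow> real ^ 'n" where "u t = uhat (\<alpha> t) (\<omega> t)"
definition x :: "nat \<Rightarrow> real ^ 'n" where "x t = uhat (b t) (\<omega> t)"
definition lyapunov :: "nat \<Rightarrow> real" where "lyapunov t = (Q t \<bullet> Q t + Z t \<bullet> Z t) / 2"
definition mean_\<gamma> :: "nat \<Rightarrow> real ^ 'n" where "mean_\<gamma> n = (1 / real n) *\<^sub>R (\<Sum>t<n. \<gamma> t)"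

lemma utility_in_box: "a \<in> joint_actions A \<Longrightarrow> uhat a (\<omega> t) \<in> cbox 0 umax"
  using utility_bounds events by (simp add: mem_box_cart)

lemma \<gamma>_maximizes:
  assumes "g \<in> cbox 0 umax"
  shows "V * \<phi> g - Z t \<bullet> g \<le> V * \<phi> (\<gamma> t) - Z t \<bullet> \<gamma> t"
proof -
  have "is_arg_max (\<lambda>g. V * \<phi> g - (\<Sum>i\<in>UNIV. Z t $ i * g $ i)) (\<lambda>g. g \<in> cbox 0 umax) (\<gamma> t)"
    using algorithm unfolding general_algorithm_def by blast
  from is_arg_max_ge[OF this assms] show ?thesis
    by (simp add: inner_vec_def)
qed

lemma \<alpha>_maximizes:
  assumes "a \<in> joint_actions A"
  shows "uhat a (\<omega> t) \<bullet> (Q t + Z t) \<le> u t \<bullet> (Q t + Z t)"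
proof -
  have "is_arg_max (\<lambda>a. \<Sum>i\<in>UNIV. uhat a (\<omega> t) $ i * (Q t $ i + Z t $ i))
      (\<lambda>a. a \<in> joint_actions A) (\<alpha> t)"
    using algorithm unfolding general_algorithm_def by blast
  from is_arg_max_ge[OF this, of a] assms show ?thesis
    by (simp add: inner_vec_def u_def)
qed

lemma \<gamma>_in_box: "\<gamma> t \<in> cbox 0 umax"
  using algorithm unfolding general_algorithm_def is_arg_max_def by blast

lemma u_in_box: "u t \<in> cbox 0 umax"
  using algorithm unfolding general_algorithm_def is_arg_max_def u_def
  by (intro utility_in_box) blast

lemma x_in_box: "x t \<in> cbox 0 umax"
  unfolding x_def by (intro utility_in_box baseline)

lemma Q_Suc: "Q (Suc t) $ i = max (Q t $ i + x t $ i - u t $ i) 0"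
  using algorithm unfolding general_algorithm_def u_def x_def by blast

lemma Z_Suc: "Z (Suc t) = Z t + \<gamma> t - u t"
  using algorithm unfolding general_algorithm_def u_def by (simp add: vec_eq_iff)

lemma Q_nonneg: "0 \<le> Q t $ i"
  by (cases t) (simp_all add: Q_init Q_Suc)

section \<open>Queue increments and one-round drift\<close>

text \<open>Since \<open>Q\<close> is nonnegative, truncation at 0 can only shorten a step, and the
  untruncated step \<open>x - u\<close> is a difference of two points of the box.\<close>

lemma Q_increment: "\<bar>(Q (t + j) - Q t) $ i\<bar> \<le> real j * umax $ i"
proof (induction j)
  case (Suc j)
  have "\<bar>Q (Suc (t + j)) $ i - Q (t + j) $ i\<bar> \<le> umax $ i"
    using abs_diff_le_of_cbox_0[OF x_in_box u_in_box, of "t + j" "t + j" i] Q_nonneg[of "t + j" i]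
    by (simp add: Q_Suc max_def) linarith
  with Suc show ?case by (simp add: algebra_simps)
qed simp

lemma Z_increment: "\<bar>(Z (t + j) - Z t) $ i\<bar> \<le> real j * umax $ i"
proof (induction j)
  case (Suc j)
  have "\<bar>Z (Suc (t + j)) $ i - Z (t + j) $ i\<bar> \<le> umax $ i"
    using abs_diff_le_of_cbox_0[OF \<gamma>_in_box u_in_box, of "t + j" "t + j" i]
    unfolding Z_Suc by simp
  with Suc show ?case by (simp add: algebra_simps)
qed simp

text \<open>Truncation at 0 never increases a square, so the drift can be computed as if
  \<open>Q\<close> were updated linearly.\<close>

lemma inner_Q_Suc: "Q (Suc t) \<bullet> Q (Suc t) \<le> (Q t + x t - u t) \<bullet> (Q t + x t - u t)"
  unfolding inner_vec_def Q_Suc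
  by (intro sum_mono) (auto simp: max_def mult_nonneg_nonneg)

text \<open>Expanding the squares leaves the linear terms and two halved quadratic terms, each at
  most half of \<open>umax \<bullet> umax\<close>.\<close>

lemma drift_bound:
  "lyapunov (Suc t) - lyapunov t \<le> umax \<bullet> umax + Q t \<bullet> (x t - u t) + Z t \<bullet> (\<gamma> t - u t)"
proof -
  have "(x t - u t) \<bullet> (x t - u t) \<le> umax \<bullet> umax" "(\<gamma> t - u t) \<bullet> (\<gamma> t - u t) \<le> umax \<bullet> umax"
    using x_in_box \<gamma>_in_box u_in_box
    by (intro inner_mono_componentwise abs_diff_le_of_cbox_0; simp)+
  then show ?thesis
    using inner_Q_Suc[of t] unfolding lyapunov_def Z_Suc
    by (simp add: inner_simps inner_commute field_simps)
qed

text \<open>After subtracting \<open>V * \<phi> (\<gamma> t)\<close>, the bound separates: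
  \<open>\<gamma> t\<close> enters through its own maximized objective with a minus sign, and so
  does \<open>\<alpha> t\<close>. Replacing either by a competitor can only enlarge the
  bound.\<close>

lemma drift_plus_penalty:
  assumes "g \<in> cbox 0 umax" "a \<in> joint_actions A"
  shows "lyapunov (Suc t) - lyapunov t - V * \<phi> (\<gamma> t)
    \<le> umax \<bullet> umax + Q t \<bullet> (x t - uhat a (\<omega> t)) + Z t \<bullet> (g - uhat a (\<omega> t)) - V * \<phi> g"
  using drift_bound[of t] \<gamma>_maximizes[OF assms(1), of t] \<alpha>_maximizes[OF assms(2), of t]
  by (simp add: inner_simps inner_commute)

lemma lyapunov_nonneg: "0 \<le> lyapunov t"
  by (simp add: lyapunov_def)

lemma lyapunov_0: "lyapunov 0 = 0"
  by (simp add: lyapunov_def Q_init Z_init)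

section \<open>Drift over a frame, compared with the lookahead policy\<close>

text \<open>The constraints on \<open>g\<close> concern sums over the frame only, so the queues are
  frozen at their values at the frame's start \<open>t\<close> to make those sums appear.\<close>

lemma frame_drift_feasible:
  assumes g: "g \<in> cbox 0 umax"
    and a: "\<And>j. j < T \<Longrightarrow> a j \<in> joint_actions A"
    and g_eq: "real T *\<^sub>R g = (\<Sum>j<T. uhat (a j) (\<omega> (t + j)))"
    and g_ge: "\<And>i. (\<Sum>j<T. x (t + j) $ i) \<le> real T * g $ i"
  shows "lyapunov (t + T) - lyapunov t - V * (\<Sum>j<T. \<phi> (\<gamma> (t + j)))
    \<le> (real T)\<^sup>2 * (umax \<bullet> umax) - V * real T * \<phi> g"
proof -
  let ?C = "umax \<bullet> umax"
  define v where "v j = uhat (a j) (\<omega> (t + j))" for j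
  \<comment> \<open>The term \<open>2 * real j * ?C\<close> is the cost of freezing: after
    \<open>j\<close> rounds each of the two queues has moved by at most \<open>j\<close> times
    \<open>umax\<close>, and it is paired with a vector bounded by \<open>umax\<close>.\<close>
  have "lyapunov (t + Suc j) - lyapunov (t + j) \<le>
      ?C + 2 * real j * ?C + Q t \<bullet> (x (t + j) - v j) + Z t \<bullet> (g - v j)
        + (V * \<phi> (\<gamma> (t + j)) - V * \<phi> g)"
    if "j < T" for j
  proof -
    have v: "v j \<in> cbox 0 umax"
      using a[OF that] unfolding v_def by (rule utility_in_box)
    have "(Q (t + j) - Q t) \<bullet> (x (t + j) - v j) \<le> (real j *\<^sub>R umax) \<bullet> umax"
      using Q_increment[of t j] abs_diff_le_of_cbox_0[OF x_in_box v]
      by (intro inner_mono_componentwise) simp_all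
    moreover have "(Z (t + j) - Z t) \<bullet> (g - v j) \<le> (real j *\<^sub>R umax) \<bullet> umax"
      using Z_increment[of t j] abs_diff_le_of_cbox_0[OF g v]
      by (intro inner_mono_componentwise) simp_all
    ultimately show ?thesis
      using drift_plus_penalty[OF g a[OF that], of "t + j"]
      by (simp add: v_def inner_diff_left)
  qed
  then have "lyapunov (t + T) - lyapunov (t + 0) \<le> (\<Sum>j<T. ?C + 2 * real j * ?C
      + Q t \<bullet> (x (t + j) - v j) + Z t \<bullet> (g - v j) + (V * \<phi> (\<gamma> (t + j)) - V * \<phi> g))"
    by (rule sum_telescope_le[where f = "\<lambda>j. lyapunov (t + j)"])
  also have "\<dots> = (\<Sum>j<T. 1 + 2 * real j) * ?C
      + Q t \<bullet> (\<Sum>j<T. x (t + j) - v j) + Z t \<bullet> (\<Sum>j<T. g - v j)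
      + (V * (\<Sum>j<T. \<phi> (\<gamma> (t + j))) - V * real T * \<phi> g)"
    by (simp add: sum.distrib inner_sum_right sum_distrib_left sum_distrib_right distrib_right
        sum_subtractf[of "\<lambda>j. V * \<phi> (\<gamma> (t + j))"])
  \<comment> \<open>The first \<open>T\<close> odd numbers sum to a square; this is the source of
    the factor \<open>T\<close> in the final error \<open>T * C / V\<close>.\<close>
  also have "(\<Sum>j<T. 1 + 2 * real j) = (real T)\<^sup>2"
    by (induction T) (simp_all add: power2_eq_square algebra_simps)
  \<comment> \<open>\<open>Z t\<close> may have either sign, so its term is removed by the exact
    equality between \<open>g\<close> and the frame average. For the nonnegative \<open>Q t\<close>,
    the inequality \<open>g_ge\<close> suffices below.\<close>
  also have "(\<Sum>j<T. g - v j) = 0"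
    using g_eq by (simp add: v_def sum_subtractf sum_constant_scaleR del: sum_constant)
  finally have "lyapunov (t + T) - lyapunov t - V * (\<Sum>j<T. \<phi> (\<gamma> (t + j)))
    \<le> (real T)\<^sup>2 * ?C - V * real T * \<phi> g + Q t \<bullet> (\<Sum>j<T. x (t + j) - v j)"
    by simp
  moreover have "Q t \<bullet> (\<Sum>j<T. x (t + j) - v j) \<le> 0"
  proof -
    have "(\<Sum>j<T. v j $ i) = real T * g $ i" for i
      using arg_cong[OF g_eq, of "\<lambda>w. w $ i"] by (simp add: v_def)
    then have "(\<Sum>j<T. x (t + j) - v j) $ i \<le> 0" for i
      using g_ge[of i] by (simp add: sum_subtractf)
    then show ?thesis
      unfolding inner_vec_def
      by (intro sum_nonpos) (simp add: Q_nonneg mult_nonneg_nonpos del: sum_component)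
  qed
  ultimately show ?thesis by simp
qed

lemma frame_drift:
  assumes T: "T > 0" and V: "V > 0"
  shows "lyapunov (Suc k * T) - lyapunov (k * T)
    \<le> (real T)\<^sup>2 * (umax \<bullet> umax) - V * real T * lookahead A uhat umax \<phi> \<omega> b T k
      + V * (\<Sum>j<T. \<phi> (\<gamma> (k * T + j)))"
proof -
  have shift: "(\<Sum>\<tau>\<in>{k * T..<(k + 1) * T}. f \<tau>) = (\<Sum>j<T. f (k * T + j))" for f :: "nat \<Rightarrow> real"
    using sum_frame[of f k T] by (simp add: add.commute)
  \<comment> \<open>\<open>D\<close> is the bound of \<open>frame_drift_feasible\<close> solved for
    \<open>\<phi> g\<close>. It is independent of \<open>g\<close>, so it bounds the supremum
    whether or not that is attained.\<close>
  define D where "D = ((real T)\<^sup>2 * (umax \<bullet> umax) + V * (\<Sum>j<T. \<phi> (\<gamma> (k * T + j)))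
    - (lyapunov (Suc k * T) - lyapunov (k * T))) / (V * real T)"
  have "lookahead A uhat umax \<phi> \<omega> b T k \<le> D"
    unfolding lookahead_def
  proof (rule cSup_least, goal_cases)
    case 1
    \<comment> \<open>\<open>cSup_least\<close> requires a nonempty set: playing the baseline
      actions satisfies the constraint with equality.\<close>
    define g where "g = (1 / real T) *\<^sub>R (\<Sum>j<T. x (k * T + j))"
    have "g \<in> cbox 0 umax"
      unfolding g_def using T x_in_box by (intro convex_average) auto
    then show ?case
      using baseline unfolding shift ex_in_conv[symmetric]
      by (intro exI[of _ "\<phi> g"] CollectI exI[of _ g] exI[of _ b] conjI) (auto simp: g_def x_def)
  next
    case (2 y)
    then obtain g a where y: "y = \<phi> g" and g: "g \<in> cbox 0 umax"
      and a: "\<And>\<tau>. \<tau> \<in> {k * T..<(k + 1) * T} \<Longrightarrow> a \<tau> \<in> joint_actions A"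
      and eq: "\<And>i. g $ i = (1 / real T) * (\<Sum>j<T. uhat (a (k * T + j)) (\<omega> (k * T + j)) $ i)"
      and ge: "\<And>i. g $ i \<ge> (1 / real T) * (\<Sum>j<T. uhat (b (k * T + j)) (\<omega> (k * T + j)) $ i)"
      unfolding shift by blast
    have "lyapunov (k * T + T) - lyapunov (k * T) - V * (\<Sum>j<T. \<phi> (\<gamma> (k * T + j)))
        \<le> (real T)\<^sup>2 * (umax \<bullet> umax) - V * real T * \<phi> g"
    proof (rule frame_drift_feasible[where a = "\<lambda>j. a (k * T + j)"])
      show "real T *\<^sub>R g = (\<Sum>j<T. uhat (a (k * T + j)) (\<omega> (k * T + j)))"
        using eq T by (simp add: vec_eq_iff)
      show "(\<Sum>j<T. x (k * T + j) $ i) \<le> real T * g $ i" for i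
        using ge[of i] T by (simp add: x_def field_simps)
    qed (use g a in auto)
    then show ?case
      using T V unfolding D_def y by (simp add: field_simps)
  qed
  then show ?thesis
    using T V unfolding D_def by (simp add: field_simps)
qed

section \<open>Averaging over frames and Jensen's inequality\<close>

lemma mean_penalty_ge:
  assumes T: "T > 0" and K: "K > 0" and V: "V > 0"
  shows "(1 / real K) * (\<Sum>k<K. lookahead A uhat umax \<phi> \<omega> b T k) - real T * (umax \<bullet> umax) / V
    \<le> (1 / real (K * T)) * (\<Sum>t<K * T. \<phi> (\<gamma> t))"
proof -
  let ?C = "umax \<bullet> umax" and ?\<Psi> = "\<Sum>k<K. lookahead A uhat umax \<phi> \<omega> b T k"
  have "lyapunov (K * T) - lyapunov (0 * T)
    \<le> (\<Sum>k<K. (real T)\<^sup>2 * ?C - V * real T * lookahead A uhat umax \<phi> \<omega> b T k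
      + V * (\<Sum>j<T. \<phi> (\<gamma> (k * T + j))))"
    by (rule sum_telescope_le[where f = "\<lambda>k. lyapunov (k * T)"]) (rule frame_drift[OF T V])
  also have "\<dots> = real K * (real T)\<^sup>2 * ?C - V * real T * ?\<Psi>
      + V * (\<Sum>k<K. \<Sum>j<T. \<phi> (\<gamma> (k * T + j)))"
    by (simp add: sum.distrib sum_subtractf sum_distrib_left)
  also have "(\<Sum>k<K. \<Sum>j<T. \<phi> (\<gamma> (k * T + j))) = (\<Sum>t<K * T. \<phi> (\<gamma> t))"
    using sum.nat_group[of "\<lambda>t. \<phi> (\<gamma> t)" T K] by (simp only: sum_frame)
  finally have "0 \<le> real K * (real T)\<^sup>2 * ?C - V * real T * ?\<Psi> + V * (\<Sum>t<K * T. \<phi> (\<gamma> t))"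
    using lyapunov_nonneg[of "K * T"] by (simp add: lyapunov_0)
  \<comment> \<open>Dividing by \<open>V * real K * real T\<close> turns both sums into averages and
    the quadratic error into \<open>real T * ?C / V\<close>.\<close>
  then have "0 \<le> (real K * (real T)\<^sup>2 * ?C - V * real T * ?\<Psi> + V * (\<Sum>t<K * T. \<phi> (\<gamma> t)))
      / (V * real K * real T)"
    using V by (intro divide_nonneg_nonneg) auto
  also have "\<dots> = real T * ?C / V - (1 / real K) * ?\<Psi> + (1 / real (K * T)) * (\<Sum>t<K * T. \<phi> (\<gamma> t))"
    using T K V by (simp add: field_simps power2_eq_square)
  finally show ?thesis by simp
qed

lemma mean_\<gamma>_in_box: "n > 0 \<Longrightarrow> mean_\<gamma> n \<in> cbox 0 umax"
  unfolding mean_\<gamma>_def by (intro convex_average) (auto simp: \<gamma>_in_box)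

lemma phi_mean_\<gamma>_ge:
  assumes "concave_on (cbox 0 umax) \<phi>" "T > 0" "K > 0" "V > 0"
  shows "(1 / real K) * (\<Sum>k<K. lookahead A uhat umax \<phi> \<omega> b T k) - real T * (umax \<bullet> umax) / V
    \<le> \<phi> (mean_\<gamma> (K * T))"
proof -
  have "(1 / real (K * T)) * (\<Sum>t<K * T. \<phi> (\<gamma> t)) \<le> \<phi> (mean_\<gamma> (K * T))"
    unfolding mean_\<gamma>_def using assms \<gamma>_in_box by (intro concave_on_average_le) auto
  with mean_penalty_ge[OF assms(2-4)] show ?thesis by linarith
qed

section \<open>Distance between the averages of the auxiliary choices and of the utilities\<close>

lemma average_utility_eq: "average_utility uhat \<omega> \<alpha> n = (1 / real n) *\<^sub>R (\<Sum>t<n. u t)"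
  by (simp add: average_utility_def u_def vec_eq_iff)

lemma average_utility_in_box: "n > 0 \<Longrightarrow> average_utility uhat \<omega> \<alpha> n \<in> cbox 0 umax"
  unfolding average_utility_eq by (intro convex_average) (auto simp: u_in_box)

text \<open>Without truncation, \<open>Z\<close> records the accumulated discrepancy exactly; this
  is how a bound on \<open>Z\<close> controls the gap between the two averages.\<close>

lemma Z_eq_sum: "Z n = (\<Sum>t<n. \<gamma> t - u t)"
  by (induction n) (simp_all add: Z_init Z_Suc)

text \<open>Take \<open>g = x t\<close> and \<open>a = b t\<close> in
  \<open>drift_plus_penalty\<close>: both inner products vanish, and the range of
  \<open>\<phi>\<close> bounds what remains by a constant per round.\<close>

lemma lyapunov_le:
  assumes V: "0 \<le> V"
    and range: "\<phi> ` cbox 0 umax \<subseteq> {0..phimax}"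
  shows "lyapunov n \<le> real n * (umax \<bullet> umax + V * phimax)"
proof -
  have "lyapunov (Suc t) - lyapunov t \<le> umax \<bullet> umax + V * phimax" for t
  proof -
    have "V * \<phi> (\<gamma> t) \<le> V * phimax" "0 \<le> V * \<phi> (x t)"
      using V range x_in_box[of t] \<gamma>_in_box[of t] by (auto intro!: mult_left_mono mult_nonneg_nonneg)
    then show ?thesis
      using drift_plus_penalty[OF x_in_box baseline, of t t t] by (simp add: x_def)
  qed
  then have "lyapunov n - lyapunov 0 \<le> (\<Sum>t<n. umax \<bullet> umax + V * phimax)"
    by (intro sum_telescope_le)
  then show ?thesis by (simp add: lyapunov_0)
qed

text \<open>The gap is \<open>Z n\<close> divided by \<open>n\<close>. The squared norm of
  \<open>Z n\<close> is at most \<open>2 * lyapunov n\<close>, hence linear in \<open>n\<close>, and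
  division by the square of \<open>n\<close> leaves order \<open>1 / n\<close>.\<close>

lemma norm_mean_\<gamma>_diff_le:
  assumes V: "0 \<le> V"
    and range: "\<phi> ` cbox 0 umax \<subseteq> {0..phimax}"
    and n: "n > 0"
  shows "norm (mean_\<gamma> n - average_utility uhat \<omega> \<alpha> n)
    \<le> sqrt ((2 * (umax \<bullet> umax) + 2 * V * phimax) / real n)"
proof (rule real_le_rsqrt)
  have "mean_\<gamma> n - average_utility uhat \<omega> \<alpha> n = (1 / real n) *\<^sub>R Z n"
    by (simp add: mean_\<gamma>_def average_utility_eq Z_eq_sum sum_subtractf scaleR_diff_right)
  then have "(norm (mean_\<gamma> n - average_utility uhat \<omega> \<alpha> n))\<^sup>2 = (Z n \<bullet> Z n) / (real n)\<^sup>2"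
    by (simp add: power_divide power2_norm_eq_inner)
  also have "\<dots> \<le> (2 * lyapunov n) / (real n)\<^sup>2"
    by (intro divide_right_mono) (simp_all add: lyapunov_def)
  also have "\<dots> \<le> (2 * (real n * (umax \<bullet> umax + V * phimax))) / (real n)\<^sup>2"
    using lyapunov_le[OF V range] by (intro divide_right_mono) simp_all
  also have "\<dots> = (2 * (umax \<bullet> umax) + 2 * V * phimax) / real n"
    using n by (simp add: power2_eq_square field_simps)
  finally show "(norm (mean_\<gamma> n - average_utility uhat \<omega> \<alpha> n))\<^sup>2
    \<le> (2 * (umax \<bullet> umax) + 2 * V * phimax) / real n" .
qed

text \<open>The gap tends to 0 and both averages stay in a compact box, where \<open>\<phi>\<close>
  is uniformly continuous.\<close>

lemma phi_average_diff_tendsto: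
  assumes V: "0 \<le> V"
    and range: "\<phi> ` cbox 0 umax \<subseteq> {0..phimax}"
    and cont: "continuous_on (cbox 0 umax) \<phi>"
  shows "(\<lambda>n. \<phi> (average_utility uhat \<omega> \<alpha> n) - \<phi> (mean_\<gamma> n)) \<longlonglongrightarrow> 0"
proof (rule tendstoI)
  fix e :: real assume "0 < e"
  have "uniformly_continuous_on (cbox 0 umax) \<phi>"
    by (intro compact_uniformly_continuous cont compact_cbox)
  then obtain d where d: "d > 0"
    "\<And>g r. g \<in> cbox 0 umax \<Longrightarrow> r \<in> cbox 0 umax \<Longrightarrow> dist r g < d \<Longrightarrow> dist (\<phi> r) (\<phi> g) < e"
    using \<open>0 < e\<close> unfolding uniformly_continuous_on_def by metis
  have "(\<lambda>n. sqrt ((2 * (umax \<bullet> umax) + 2 * V * phimax) / real n)) \<longlonglongrightarrow> sqrt 0"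
    by (intro tendsto_real_sqrt lim_const_over_n)
  then have "\<forall>\<^sub>F n in sequentially. sqrt ((2 * (umax \<bullet> umax) + 2 * V * phimax) / real n) < d"
    using \<open>d > 0\<close> by (intro order_tendstoD) simp_all
  with eventually_gt_at_top[of 0]
  show "\<forall>\<^sub>F n in sequentially. dist (\<phi> (average_utility uhat \<omega> \<alpha> n) - \<phi> (mean_\<gamma> n)) 0 < e"
  proof eventually_elim
    case (elim n)
    have "dist (average_utility uhat \<omega> \<alpha> n) (mean_\<gamma> n) < d"
      using norm_mean_\<gamma>_diff_le[OF V range \<open>0 < n\<close>] elim
      by (simp add: dist_norm norm_minus_commute)
    then show ?case
      using d(2)[OF mean_\<gamma>_in_box average_utility_in_box] elim by (simp add: dist_norm)
  qed
qed

end

section \<open>The finite-horizon bound and the limit inferior\<close>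

theorem mainTheorem5:
  fixes Omega :: "'w set"
    and A :: "'n::finite \<Rightarrow> 'a set"
    and uhat :: "('n \<Rightarrow> 'a) \<Rightarrow> 'w \<Rightarrow> real ^ 'n"
    and umax :: "real ^ 'n"
    and \<phi> :: "real ^ 'n \<Rightarrow> real"
    and V C phimax :: real
    and \<omega> :: "nat \<Rightarrow> 'w"
    and b \<alpha> :: "nat \<Rightarrow> 'n \<Rightarrow> 'a"
    and \<gamma> Q Z :: "nat \<Rightarrow> real ^ 'n"
  assumes game: "stochastic_game Omega A uhat umax"
    and phi_concave: "concave_on (cbox 0 umax) \<phi>"
    and phi_continuous: "continuous_on (cbox 0 umax) \<phi>"
    and phi_nonneg: "\<And>g. g \<in> cbox 0 umax \<Longrightarrow> 0 \<le> \<phi> g"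
    and phimax_attained: "phimax \<in> \<phi> ` cbox 0 umax"
    and phimax_upper: "\<And>g. g \<in> cbox 0 umax \<Longrightarrow> \<phi> g \<le> phimax"
    and C_eq: "C = (\<Sum>i\<in>UNIV. (umax $ i)\<^sup>2)"
    and V_nonneg: "0 \<le> V"
    and events: "\<And>t. \<omega> t \<in> Omega"
    and baseline: "\<And>t. b t \<in> joint_actions A"
    and algorithm: "general_algorithm A uhat umax \<phi> V \<omega> b \<gamma> \<alpha> Q Z"
    and Q_init: "Q 0 = 0"
    and Z_init: "Z 0 = 0"
  shows "(\<forall>M>0. (\<forall>g\<in>cbox 0 umax. \<forall>r\<in>cbox 0 umax. \<bar>\<phi> g - \<phi> r\<bar> \<le> M * norm (g - r)) \<longrightarrow>
            (\<forall>T>0. \<forall>K>0.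
              ereal (\<phi> (average_utility uhat \<omega> \<alpha> (K * T)))
                \<ge> ereal ((1 / real K) * (\<Sum>k<K. lookahead A uhat umax \<phi> \<omega> b T k))
                    - divide_or_infty (real T * C) V
                    - ereal (M * sqrt ((2 * C + 2 * V * phimax) / real (K * T)))))
       \<and> (\<forall>T>0. liminf (\<lambda>K. ereal (\<phi> (average_utility uhat \<omega> \<alpha> (K * T))
                    - (1 / real K) * (\<Sum>k<K. lookahead A uhat umax \<phi> \<omega> b T k)))
                \<ge> - divide_or_infty (real T * C) V)"
proof -
  interpret algorithm_run Omega A uhat umax \<phi> V \<omega> b \<alpha> \<gamma> Q Z
    using game events baseline algorithm Q_init Z_init
    by (simp add: algorithm_run_def algorithm_run_axioms_def)
  have C: "C = umax \<bullet> umax"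
    by (simp add: C_eq inner_vec_def power2_eq_square)
  show ?thesis
  proof (cases "V = 0")
    \<comment> \<open>With \<open>V = 0\<close> an infinite term is subtracted, so both lower bounds
      equal minus infinity.\<close>
    case True
    then show ?thesis by (simp add: divide_or_infty_def)
  next
    case False
    with V_nonneg have V: "V > 0" by simp
    have range: "\<phi> ` cbox 0 umax \<subseteq> {0..phimax}"
      using phi_nonneg phimax_upper by auto
    note close = norm_mean_\<gamma>_diff_le[OF V_nonneg range, folded C]
    note mean_ge = phi_mean_\<gamma>_ge[OF phi_concave _ _ V, folded C]
    show ?thesis
    proof (intro conjI allI impI)
      fix M :: real and T K :: nat
      assume M: "0 < M" "\<forall>g\<in>cbox 0 umax. \<forall>r\<in>cbox 0 umax. \<bar>\<phi> g - \<phi> r\<bar> \<le> M * norm (g - r)"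
        and TK: "0 < T" "0 < K"
      let ?n = "K * T"
      have n: "?n > 0" using TK by simp
      \<comment> \<open>The Lipschitz condition transfers the bound from the mean of
        \<open>\<gamma>\<close> to the mean utility, at the price of the square-root term.\<close>
      have "\<bar>\<phi> (mean_\<gamma> ?n) - \<phi> (average_utility uhat \<omega> \<alpha> ?n)\<bar>
          \<le> M * norm (mean_\<gamma> ?n - average_utility uhat \<omega> \<alpha> ?n)"
        using M(2) mean_\<gamma>_in_box[OF n] average_utility_in_box[OF n] by blast
      also have "\<dots> \<le> M * sqrt ((2 * C + 2 * V * phimax) / real ?n)"
        using M(1) close[OF n] by (intro mult_left_mono) simp_all
      finally have "(1 / real K) * (\<Sum>k<K. lookahead A uhat umax \<phi> \<omega> b T k) - real T * C / V
          - M * sqrt ((2 * C + 2 * V * phimax) / real ?n) \<le> \<phi> (average_utility uhat \<omega> \<alpha> ?n)"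
        using mean_ge[OF TK] by linarith
      then show "ereal (\<phi> (average_utility uhat \<omega> \<alpha> ?n))
          \<ge> ereal ((1 / real K) * (\<Sum>k<K. lookahead A uhat umax \<phi> \<omega> b T k))
            - divide_or_infty (real T * C) V
            - ereal (M * sqrt ((2 * C + 2 * V * phimax) / real ?n))"
        by (simp only: divide_or_infty_def False if_False ereal_minus(1) ereal_less_eq(3))
    next
      fix T :: nat
      assume T: "0 < T"
      let ?d = "\<lambda>n. \<phi> (average_utility uhat \<omega> \<alpha> n) - \<phi> (mean_\<gamma> n)"
      let ?f = "\<lambda>K. \<phi> (average_utility uhat \<omega> \<alpha> (K * T))
        - (1 / real K) * (\<Sum>k<K. lookahead A uhat umax \<phi> \<omega> b T k)"
      have "filterlim (\<lambda>K. K * T) at_top sequentially"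
        using T by (intro filterlim_at_top_mono[OF filterlim_ident]) auto
      from filterlim_compose[OF
          phi_average_diff_tendsto[OF V_nonneg range phi_continuous] this]
      have "(\<lambda>K. ?d (K * T) - real T * C / V) \<longlonglongrightarrow> 0 - real T * C / V"
        by (intro tendsto_diff tendsto_const)
      \<comment> \<open>\<open>?f\<close> itself may fail to converge; it is bounded below, for
        \<open>K > 0\<close>, by this convergent sequence, whose limit inferior is its
        limit.\<close>
      then have "liminf (\<lambda>K. ereal (?d (K * T) - real T * C / V)) = ereal (- (real T * C / V))"
        by (intro lim_imp_Liminf) simp_all
      moreover have "\<forall>\<^sub>F K in sequentially. ereal (?d (K * T) - real T * C / V) \<le> ereal (?f K)"
        using eventually_gt_at_top[of 0]
      proof eventually_elim
        case (elim K)
        from mean_ge[OF T elim] show ?case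
          by (simp only: ereal_less_eq(3))
      qed
      then have "liminf (\<lambda>K. ereal (?d (K * T) - real T * C / V)) \<le> liminf (\<lambda>K. ereal (?f K))"
        by (rule Liminf_mono)
      ultimately show "- divide_or_infty (real T * C) V \<le> liminf (\<lambda>K. ereal (?f K))"
        using False by (simp add: divide_or_infty_def)
    qed
  qed
qed

end
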